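(* Let $\delta_{oct}$ be the Hausdorff dimension of the alphabet $\mathcal{A}_{oct}=8\mathbb{N}-7=\{1,9,17,\ldots\}$ and $\delta_{even}$ that of $\mathcal{A}_{even}=2\mathbb{N}=\{2,4,6,\ldots\}$, and let $\bar\delta=\max(\delta_{oct},\delta_{even})$. Then a finite alphabet $\mathcal{A}\subset\mathbb{N}$ has no local obstructions if $\delta_{\mathcal{A}}>\bar\delta$.
   Context: For an alphabet $\mathcal{A}\subset\mathbb{N}$, $\delta_{\mathcal{A}}$ is the Hausdorff dimension of the set of irrationals in $(0,1)$ whose continued fraction partial quotients all lie in $\mathcal{A}$. For $a\in\mathbb{N}$ let $\gamma_a=\begin{pmatrix}0&1\\1&a\end{pmatrix}$ and let $\mathcal{G}_{\mathcal{A}}$ be the semigroup generated by $\gamma_a$, $a\in\mathcal{A}$. Let $\mathfrak{D}_{\mathcal{A}}=\{\langle \gamma e_2,e_2\rangle:\gamma\in\mathcal{G}_{\mathcal{A}}\}$ (the denominators of rationals with all partial quotients in $\mathcal{A}$). An integer $d$ is admissible if for every $q\in\mathbb{N}$, $d\bmod q$ lies in $\mathfrak{D}_{\mathcal{A}}\bmod q$; $\mathcal{A}$ has no local obstructions if every integer is admissible. *)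

theory Defs
  imports "HOL-Analysis.Analysis"
begin

section \<open>Hausdorff measure and dimension (subsets of the real line)\<close>

definition hausdorff_pre :: "real \<Rightarrow> real \<Rightarrow> real set \<Rightarrow> ennreal" where
  "hausdorff_pre s \<delta> E =
     (INF U \<in> {U :: nat \<Rightarrow> real set. E \<subseteq> (\<Union>i. U i) \<and>
                  (\<forall>i. bounded (U i) \<and> diameter (U i) \<le> \<delta>)}.
        (\<Sum>i. ennreal (diameter (U i) powr s)))"

definition hausdorff_measure :: "real \<Rightarrow> real set \<Rightarrow> ennreal" where
  "hausdorff_measure s E = (SUP \<delta> \<in> {0<..}. hausdorff_pre s \<delta> E)"

text \<open>Hausdorff dimension: infimum of the positive exponents s with H^s(E) = 0
  (H^s is non-increasing in s, so restricting to s > 0 gives the usual value).\<close>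
definition hausdorff_dim :: "real set \<Rightarrow> real" where
  "hausdorff_dim E = Inf {s. s > 0 \<and> hausdorff_measure s E = 0}"

section \<open>Continued fractions\<close>

definition gauss_map :: "real \<Rightarrow> real" where
  "gauss_map x = frac (1 / x)"

text \<open>(n+1)-th partial quotient of x in (0,1): a_{n+1}(x) = floor(1 / T^n x).\<close>
definition cf_digit :: "real \<Rightarrow> nat \<Rightarrow> nat" where
  "cf_digit x n = nat \<lfloor>1 / ((gauss_map ^^ n) x)\<rfloor>"

definition cf_set :: "nat set \<Rightarrow> real set" where
  "cf_set A = {x. 0 < x \<and> x < 1 \<and> x \<notin> \<rat> \<and> (\<forall>n. cf_digit x n \<in> A)}"

definition delta :: "nat set \<Rightarrow> real" where
  "delta A = hausdorff_dim (cf_set A)"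

section \<open>The semigroup and its denominators\<close>

definition gamma :: "nat \<Rightarrow> int^2^2" where
  "gamma a = vector [vector [0, 1], vector [1, int a]]"

definition semigroup_G :: "nat set \<Rightarrow> (int^2^2) set" where
  "semigroup_G A = {foldr (**) (map gamma as) (mat 1) | as. as \<noteq> [] \<and> set as \<subseteq> A}"

text \<open>\<langle>\<gamma> e_2, e_2\<rangle> is the (2,2) entry of \<gamma>.\<close>
definition denominators :: "nat set \<Rightarrow> int set" where
  "denominators A = {M $ 2 $ 2 | M. M \<in> semigroup_G A}"

definition admissible :: "nat set \<Rightarrow> int \<Rightarrow> bool" where
  "admissible A d = (\<forall>q::int. q \<ge> 1 \<longrightarrow> (\<exists>m \<in> denominators A. d mod q = m mod q))"

definition no_local_obstructions :: "nat set \<Rightarrow> bool" where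
  "no_local_obstructions A = (\<forall>d::int. admissible A d)"

definition A_oct :: "nat set" where
  "A_oct = {n. n mod 8 = 1}"

definition A_even :: "nat set" where
  "A_even = {n. n > 0 \<and> even n}"

end

theory Submission
  imports Defs "HOL-Number_Theory.Number_Theory"
begin

text \<open>
  Let \<open>d\<close> be the greatest common divisor of the differences of elements of \<open>A\<close>, so that \<open>A\<close> lies in
  an arithmetic progression of step \<open>d\<close>. If \<open>A\<close> can be mapped into the even numbers or into the
  numbers congruent to 1 mod 8 by a digitwise map that does not increase digits and keeps distinct
  digits at distance at least 2, the inverse of the induced map on continued fractions is
  Lipschitz, and the dimension of \<open>A\<close> is at most that of the target. Hence the hypothesis
  forces \<open>1 \<le> d \<le> 7\<close> and \<open>A \<subseteq> 1 + d\<int>\<close>.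

  Modulo \<open>q\<close> the semigroup is a group containing the elementary matrices with off-diagonal entry \<open>d\<close>.
  Acting on a bottom row \<open>(w, z)\<close> they reach every denominator congruent to \<open>z\<close> modulo
  \<open>d * gcd w d\<close>. The rows of the powers of a single generator, which are Fibonacci numbers mod \<open>d\<close>,
  then cover all residues; only \<open>d = 4\<close> requires looking mod 8.
\<close>

section \<open>Lipschitz maps and Hausdorff dimension\<close>

lemma hausdorff_measure_eq_0_iff:
  "hausdorff_measure s E = 0 \<longleftrightarrow> (\<forall>\<delta>>0. hausdorff_pre s \<delta> E = 0)"
  unfolding hausdorff_measure_def by (auto simp: SUP_eq_iff bot_ennreal[symmetric] SUP_bot_conv)

text \<open>The inverse of \<open>g\<close> on its image is Lipschitz with constant
  \<open>L\<close>, so pulling back a cover of \<open>F\<close> of mesh \<open>\<delta> / L\<close>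
  gives a cover of \<open>E\<close> of mesh \<open>\<delta>\<close>, and the sum of s-th powers
  grows at most by the factor \<open>L powr s\<close>.\<close>

lemma hausdorff_measure_0_expanding:
  fixes g :: "real \<Rightarrow> real"
  assumes L: "L > 0" and gF: "g ` E \<subseteq> F"
    and expand: "\<And>x y. x \<in> E \<Longrightarrow> y \<in> E \<Longrightarrow> \<bar>x - y\<bar> \<le> L * \<bar>g x - g y\<bar>"
    and s: "s > 0" and F0: "hausdorff_measure s F = 0"
  shows "hausdorff_measure s E = 0"
  unfolding hausdorff_measure_eq_0_iff
proof (intro allI impI)
  fix \<delta> :: real assume \<delta>: "\<delta> > 0"
  have pre: "hausdorff_pre s (\<delta> / L) F = 0"
    using F0 \<delta> L unfolding hausdorff_measure_eq_0_iff by simp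
  have bound: "hausdorff_pre s \<delta> E \<le> ennreal (L powr s) * (\<Sum>i. ennreal (diameter (U i) powr s))"
    if U: "F \<subseteq> (\<Union>i. U i)" "\<And>i. bounded (U i)" "\<And>i. diameter (U i) \<le> \<delta> / L"
    for U :: "nat \<Rightarrow> real set"
  proof -
    define V where "V i = E \<inter> g -` U i" for i
    have dV: "dist x y \<le> L * diameter (U i)" if "x \<in> V i" "y \<in> V i" for x y i
    proof -
      have "\<bar>x - y\<bar> \<le> L * \<bar>g x - g y\<bar>" using that expand by (auto simp: V_def)
      also have "\<dots> \<le> L * diameter (U i)"
        using diameter_bounded_bound[OF U(2)[of i], of "g x" "g y"] that L
        by (auto simp: V_def dist_real_def)
      finally show ?thesis by (simp add: dist_real_def)
    qed
    have diamV: "diameter (V i) \<le> L * diameter (U i)" for i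
      by (rule diameter_le) (use L dV[of _ i] diameter_ge_0[OF U(2)[of i]] in \<open>auto simp: dist_norm\<close>)
    have bV: "bounded (V i)" for i
    proof (cases "V i = {}")
      case False
      then obtain x where "x \<in> V i" by blast
      then show ?thesis unfolding bounded_def using dV[of x i] by blast
    qed simp
    have "hausdorff_pre s \<delta> E \<le> (\<Sum>i. ennreal (diameter (V i) powr s))"
      unfolding hausdorff_pre_def
    proof (rule INF_lower, safe)
      fix x assume "x \<in> E"
      then have "g x \<in> (\<Union>i. U i)" using gF U(1) by blast
      then show "x \<in> (\<Union>i. V i)" using \<open>x \<in> E\<close> by (auto simp: V_def)
    next
      fix i
      have "L * diameter (U i) \<le> \<delta>" using U(3)[of i] L by (simp add: field_simps)
      then show "diameter (V i) \<le> \<delta>" using diamV[of i] by linarith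
    qed (rule bV)
    also have "\<dots> \<le> (\<Sum>i. ennreal (L powr s) * ennreal (diameter (U i) powr s))"
    proof (rule suminf_le)
      fix i
      have "diameter (V i) powr s \<le> (L * diameter (U i)) powr s"
        using diamV[of i] diameter_ge_0[OF bV[of i]] s by (intro powr_mono2) auto
      also have "\<dots> = L powr s * diameter (U i) powr s"
        using L diameter_ge_0[OF U(2)[of i]] by (simp add: powr_mult)
      finally show "ennreal (diameter (V i) powr s) \<le> ennreal (L powr s) * ennreal (diameter (U i) powr s)"
        by (simp add: ennreal_mult[symmetric] ennreal_leI)
    qed auto
    also have "\<dots> = ennreal (L powr s) * (\<Sum>i. ennreal (diameter (U i) powr s))"
      by (rule ennreal_suminf_cmult)
    finally show ?thesis .
  qed
  have "hausdorff_pre s \<delta> E \<le> ennreal e" if e: "e > 0" for e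
  proof -
    have "hausdorff_pre s (\<delta> / L) F < ennreal (e / L powr s)"
      using pre e L by simp
    then obtain U where U: "F \<subseteq> (\<Union>i. U i)" "\<And>i. bounded (U i)" "\<And>i. diameter (U i) \<le> \<delta> / L"
      and lt: "(\<Sum>i. ennreal (diameter (U i) powr s)) < ennreal (e / L powr s)"
      unfolding hausdorff_pre_def INF_less_iff by auto
    have "hausdorff_pre s \<delta> E \<le> ennreal (L powr s) * ennreal (e / L powr s)"
      using order_trans[OF bound[OF U] mult_left_mono[OF less_imp_le[OF lt]]] by simp
    also have "\<dots> = ennreal e" using L e by (simp add: ennreal_mult[symmetric])
    finally show ?thesis .
  qed
  then show "hausdorff_pre s \<delta> E = 0"
    by (metis ennreal_le_epsilon add_0 le_zero_eq)
qed

text \<open>Cutting into n intervals of length 1/n gives the sum n * (1/n)^2 = 1/n. The exponent 2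
  serves as a witness that the set whose \<open>Inf\<close> defines the dimension is nonempty,
  without which \<open>Inf\<close> on the reals could not be compared.\<close>

lemma hausdorff_measure_2_unit_interval: "hausdorff_measure 2 {0<..<1} = 0"
  unfolding hausdorff_measure_eq_0_iff
proof (intro allI impI)
  fix \<delta> :: real assume \<delta>: "\<delta> > 0"
  have bound: "hausdorff_pre 2 \<delta> {0<..<1} \<le> ennreal (1 / real n)" if n: "n > 0" "1 / real n \<le> \<delta>" for n :: nat
  proof -
    define U where "U i = (if i < n then {real i / real n .. (real i + 1) / real n} else {})" for i
    have dU: "diameter (U i) = (if i < n then 1 / real n else 0)" for i
      using n by (auto simp: U_def diameter_closed_interval field_simps)
    have "hausdorff_pre 2 \<delta> {0<..<1} \<le> (\<Sum>i. ennreal (diameter (U i) powr 2))"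
      unfolding hausdorff_pre_def
    proof (rule INF_lower, safe)
      fix x :: real assume x: "x \<in> {0<..<1}"
      define i where "i = nat \<lfloor>x * real n\<rfloor>"
      have i: "real i \<le> x * real n" "x * real n < real i + 1"
        using x n by (auto simp: i_def)
      have "x * real n < real n" using x n by simp
      then have "i < n" using i by linarith
      then have "x \<in> U i" using i n by (auto simp: U_def field_simps)
      then show "x \<in> (\<Union>i. U i)" by blast
    next
      fix i show "bounded (U i)" by (auto simp: U_def)
      show "diameter (U i) \<le> \<delta>" using dU[of i] n \<delta> by auto
    qed
    also have "\<dots> = (\<Sum>i\<in>{..<n}. ennreal (diameter (U i) powr 2))"
      by (rule suminf_finite) (auto simp: dU)
    also have "\<dots> = (\<Sum>i\<in>{..<n}. ennreal ((1 / real n)\<^sup>2))"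
      using n by (intro sum.cong) (auto simp: dU powr_numeral)
    also have "\<dots> = ennreal (real n * (1 / real n)\<^sup>2)"
      by (simp add: ennreal_of_nat_eq_real_of_nat ennreal_mult)
    also have "real n * (1 / real n)\<^sup>2 = 1 / real n" using n by (simp add: power2_eq_square)
    finally show ?thesis .
  qed
  have "hausdorff_pre 2 \<delta> {0<..<1} \<le> ennreal e" if e: "e > 0" for e
  proof -
    obtain n :: nat where n: "n > 0" "1 / real n < min e \<delta>"
      using real_arch_inverse[of "min e \<delta>"] e \<delta> by (auto simp: inverse_eq_divide)
    then show ?thesis using bound[of n] by (meson ennreal_leI less_imp_le min.strict_boundedE order_trans)
  qed
  then show "hausdorff_pre 2 \<delta> {0<..<1} = 0"
    by (metis ennreal_le_epsilon add_0 le_zero_eq)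
qed

lemma hausdorff_dim_le_expanding:
  fixes g :: "real \<Rightarrow> real"
  assumes "L > 0" "g ` E \<subseteq> F" "F \<subseteq> {0<..<1}"
    and "\<And>x y. x \<in> E \<Longrightarrow> y \<in> E \<Longrightarrow> \<bar>x - y\<bar> \<le> L * \<bar>g x - g y\<bar>"
  shows "hausdorff_dim E \<le> hausdorff_dim F"
  unfolding hausdorff_dim_def
proof (rule cInf_superset_mono)
  have "hausdorff_measure 2 F = 0"
    using assms(3) by (intro hausdorff_measure_0_expanding[of 1 id F, OF _ _ _ _ hausdorff_measure_2_unit_interval]) auto
  then show "{s. s > 0 \<and> hausdorff_measure s F = 0} \<noteq> {}" by (auto intro!: exI[of _ 2])
  show "bdd_below {s. s > 0 \<and> hausdorff_measure s E = 0}" by (rule bdd_belowI[of _ 0]) auto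
  show "{s. s > 0 \<and> hausdorff_measure s F = 0} \<subseteq> {s. s > 0 \<and> hausdorff_measure s E = 0}"
    using hausdorff_measure_0_expanding[OF assms(1,2,4)] by auto
qed

section \<open>Continued fractions with prescribed digits\<close>

text \<open>For positive digits this is the closed cylinder of all [0; b 0, ..., b (n-1) + x] with x
  in [0,1]. Keeping the endpoints makes it compact, so that nested cylinders have a common
  point.\<close>

primrec cf_cylinder :: "(nat \<Rightarrow> nat) \<Rightarrow> nat \<Rightarrow> real set" where
  "cf_cylinder b 0 = {0..1}"
| "cf_cylinder b (Suc n) = (\<lambda>x. 1 / (real (b 0) + x)) ` cf_cylinder (\<lambda>i. b (Suc i)) n"

lemma cf_cylinder_subset: "(\<And>i. b i \<ge> 1) \<Longrightarrow> cf_cylinder b n \<subseteq> {0..1}"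
proof (induction n arbitrary: b)
  case (Suc n)
  have "cf_cylinder (\<lambda>i. b (Suc i)) n \<subseteq> {0..1}" by (rule Suc.IH) (rule Suc.prems)
  moreover have "1 / (real (b 0) + x) \<in> {0..1}" if "x \<in> {0..1}" for x
    using that Suc.prems[of 0] by (auto simp: divide_le_eq_1)
  ultimately show ?case unfolding cf_cylinder.simps by blast
qed auto

lemma cf_cylinder_compact: "(\<And>i. b i \<ge> 1) \<Longrightarrow> compact (cf_cylinder b n)"
proof (induction n arbitrary: b)
  case (Suc n)
  have "real (b 0) + x \<noteq> 0" if "x \<in> cf_cylinder (\<lambda>i. b (Suc i)) n" for x
  proof -
    have "cf_cylinder (\<lambda>i. b (Suc i)) n \<subseteq> {0..1}"
      by (rule cf_cylinder_subset) (rule Suc.prems)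
    then have "0 \<le> x" using that by auto
    then show ?thesis using Suc.prems[of 0] by linarith
  qed
  then show ?case using Suc by (auto intro!: compact_continuous_image continuous_intros)
qed auto

lemma cf_cylinder_nonempty: "cf_cylinder b n \<noteq> {}"
  by (induction n arbitrary: b) auto

lemma cf_cylinder_Suc_subset: "(\<And>i. b i \<ge> 1) \<Longrightarrow> cf_cylinder b (Suc n) \<subseteq> cf_cylinder b n"
proof (induction n arbitrary: b)
  case 0
  then show ?case using cf_cylinder_subset[of b 1] by simp
next
  case (Suc n)
  have "cf_cylinder (\<lambda>i. b (Suc i)) (Suc n) \<subseteq> cf_cylinder (\<lambda>i. b (Suc i)) n"
    by (rule Suc.IH) (rule Suc.prems)
  then show ?case unfolding cf_cylinder.simps(2)[of b] by (rule image_mono)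
qed

lemma cf_cylinder_Inter_nonempty:
  assumes "\<And>i. b i \<ge> 1"
  shows "(\<Inter>n. cf_cylinder b n) \<noteq> {}"
proof (rule compact_nest)
  show "cf_cylinder b n \<subseteq> cf_cylinder b m" if "m \<le> n" for m n
    using lift_Suc_antimono_le[of "cf_cylinder b", OF cf_cylinder_Suc_subset[OF assms] that] .
qed (simp_all add: cf_cylinder_compact[OF assms] cf_cylinder_nonempty)

lemma cf_cylinder_Inter_step:
  assumes b: "\<And>i. b i \<ge> 1" and x: "x \<in> (\<Inter>n. cf_cylinder b n)"
  obtains y where "y \<in> (\<Inter>n. cf_cylinder (\<lambda>i. b (Suc i)) n)" "x = 1 / (real (b 0) + y)"
proof -
  \<comment> \<open>The preimage found at each level \<open>n\<close> is determined by
    \<open>x\<close> alone, so one \<open>y\<close> works for all levels.\<close>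
  define y where "y = 1 / x - real (b 0)"
  have *: "y \<in> cf_cylinder (\<lambda>i. b (Suc i)) n \<and> x = 1 / (real (b 0) + y)" for n
  proof -
    have "x \<in> cf_cylinder b (Suc n)" using x by blast
    then obtain z where z: "z \<in> cf_cylinder (\<lambda>i. b (Suc i)) n" "x = 1 / (real (b 0) + z)" by auto
    then have "y = z" by (simp add: y_def)
    then show ?thesis using z by simp
  qed
  then show thesis using that[of y] by blast
qed

text \<open>This is Euclid's algorithm: the Gauss map sends p/q to (q mod p)/p, so the numerators
  decrease until one is 0.\<close>

lemma cf_tail_0_if_rational:
  assumes "x \<in> \<rat>" "0 \<le> x" "x < 1"
  shows "\<exists>n. (gauss_map ^^ n) x = 0"
proof -
  have "\<exists>n. (gauss_map ^^ n) (real p / real q) = 0" if "p < q" for p q :: nat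
    using that
  proof (induction p arbitrary: q rule: less_induct)
    case (less p)
    show ?case
    proof (cases "p = 0")
      case True
      then show ?thesis by (intro exI[of _ 0]) simp
    next
      case False
      have "gauss_map (real p / real q) = frac (real q / real p)" by (simp add: gauss_map_def)
      also have "\<dots> = real (q mod p) / real p"
      proof -
        have "real q / real p = real (q div p) + real (q mod p) / real p"
        proof -
          have "real q = real (q div p) * real p + real (q mod p)"
            by (metis of_nat_add of_nat_mult div_mult_mod_eq)
          then show ?thesis using False by (simp add: field_simps)
        qed
        moreover have "real (q mod p) / real p < 1" "real (q mod p) / real p \<ge> 0" using False by auto
        ultimately show ?thesis by (subst frac_unique_iff) auto
      qed
      finally have g: "gauss_map (real p / real q) = real (q mod p) / real p" .
      obtain n where "(gauss_map ^^ n) (real (q mod p) / real p) = 0"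
        using less.IH[of "q mod p" p] False by auto
      then show ?thesis by (intro exI[of _ "Suc n"]) (simp add: funpow_swap1 g del: funpow.simps add: funpow_Suc_right)
    qed
  qed
  moreover obtain p q :: nat where "q \<noteq> 0" "x = real p / real q"
    using Rats_abs_nat_div_natE[OF assms(1)] assms(2) by (metis abs_of_nonneg)
  moreover from this have "p < q" using assms(3) by (simp add: divide_less_eq_1)
  ultimately show ?thesis by blast
qed

lemma cf_tail:
  assumes "x \<in> cf_set A"
  shows "(gauss_map ^^ n) x \<in> {0<..<1}"
    and "(gauss_map ^^ n) x = 1 / (real (cf_digit x n) + (gauss_map ^^ Suc n) x)"
proof -
  let ?X = "\<lambda>n. (gauss_map ^^ n) x"
  have irr: "?X n \<notin> \<rat> \<and> 0 < ?X n \<and> ?X n < 1" for n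
  proof (induction n)
    case 0
    then show ?case using assms by (auto simp: cf_set_def)
  next
    case (Suc n)
    have "frac (1 / ?X n) \<notin> \<rat>"
    proof
      assume "frac (1 / ?X n) \<in> \<rat>"
      then have "1 / ?X n \<in> \<rat>" unfolding frac_def
        by (metis Rats_add Rats_of_int diff_add_cancel)
      then show False using Rats_inverse[of "1 / ?X n"] Suc by simp
    qed
    moreover from this have "frac (1 / ?X n) \<noteq> 0" by (metis Rats_0)
    moreover have "?X (Suc n) = frac (1 / ?X n)" by (simp add: gauss_map_def[of "?X n"])
    ultimately show ?case using frac_ge_0[of "1 / ?X n"] frac_lt_1[of "1 / ?X n"]
      by (metis less_eq_real_def)
  qed
  then show "?X n \<in> {0<..<1}" by auto
  have "1 / ?X n = real (cf_digit x n) + ?X (Suc n)"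
    using irr[of n] by (simp add: gauss_map_def[of "?X n"] cf_digit_def frac_def)
  then show "?X n = 1 / (real (cf_digit x n) + ?X (Suc n))"
    by (metis div_by_1 divide_divide_eq_right mult_1)
qed

text \<open>A point common to all cylinders of \<open>b\<close> has the right digits, once its Gauss
  orbit is known to avoid the endpoints 0 and 1, where digits are ambiguous or the expansion
  stops.\<close>

lemma cf_digits_realizable:
  assumes b: "\<And>i. b i \<ge> 1" and bB: "\<And>i. b i \<in> B"
  shows "\<exists>x\<in>cf_set B. \<forall>n. cf_digit x n = b n"
proof -
  define K where "K n = (\<Inter>m. cf_cylinder (\<lambda>i. b (i + n)) m)" for n
  have K01: "K n \<subseteq> {0..1}" for n
  proof -
    have "K n \<subseteq> cf_cylinder (\<lambda>i. b (i + n)) 0" unfolding K_def by blast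
    then show ?thesis by simp
  qed
  have Kstep: "\<exists>y\<in>K (Suc n). x = 1 / (real (b n) + y)" if "x \<in> K n" for x n
  proof -
    obtain y where "y \<in> (\<Inter>m. cf_cylinder (\<lambda>i. b (Suc i + n)) m)" "x = 1 / (real (b (0 + n)) + y)"
      by (rule cf_cylinder_Inter_step[OF b, of x "\<lambda>i. i + n"]) (use \<open>x \<in> K n\<close> in \<open>simp_all add: K_def\<close>)
    then show ?thesis unfolding K_def by (intro bexI[of _ y]) simp_all
  qed
  \<comment> \<open>Positivity comes first, at every level; applied to the next tail it makes the
    denominator exceed 1, which gives \<open>x < 1\<close>.\<close>
  have Kopen: "x \<in> {0<..<1}" if xK: "x \<in> K n" for x n
  proof -
    have pos: "x > 0" if x: "x \<in> K n" for x n
    proof -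
      obtain y where y: "y \<in> K (Suc n)" "x = 1 / (real (b n) + y)" using Kstep[OF x] by blast
      then have "y \<ge> 0" using K01[of "Suc n"] by auto
      then show ?thesis using b[of n] y(2) by simp
    qed
    obtain y where y: "y \<in> K (Suc n)" "x = 1 / (real (b n) + y)" using Kstep[OF xK] by blast
    then have "x < 1" using pos[OF y(1)] b[of n] by simp
    then show ?thesis using pos[OF xK] by simp
  qed
  have gauss: "gauss_map x \<in> K (Suc n) \<and> nat \<lfloor>1 / x\<rfloor> = b n" if xK: "x \<in> K n" for x n
  proof -
    obtain y where y: "y \<in> K (Suc n)" "x = 1 / (real (b n) + y)" using Kstep[OF xK] by blast
    have y01: "0 \<le> y" "y < 1" using Kopen[OF y(1)] by auto
    then have "frac (real (b n) + y) = y" by (subst frac_unique_iff) auto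
    moreover have "\<lfloor>real (b n) + y\<rfloor> = int (b n)" using y01 by (simp add: floor_eq_iff)
    ultimately show ?thesis using y by (simp add: gauss_map_def)
  qed
  obtain x where x: "x \<in> K 0"
    using cf_cylinder_Inter_nonempty[of b, OF b] by (auto simp: K_def)
  have iter: "(gauss_map ^^ n) x \<in> K n" for n
    by (induction n) (use x gauss in auto)
  have "x \<notin> \<rat>"
  proof
    assume "x \<in> \<rat>"
    then obtain n where "(gauss_map ^^ n) x = 0" using cf_tail_0_if_rational[of x] Kopen[OF x] by auto
    then show False using Kopen[OF iter[of n]] by simp
  qed
  then have "x \<in> cf_set B" "\<forall>n. cf_digit x n = b n"
    using Kopen[OF x] gauss[OF iter] bB by (auto simp: cf_set_def cf_digit_def)
  then show ?thesis by blast
qed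


section \<open>Lowering digits\<close>

text \<open>Digits and Gauss orbit are retained only through their recursion, so that the estimates
  below need neither floors nor fractional parts.\<close>

definition cf_tails :: "(nat \<Rightarrow> nat) \<Rightarrow> (nat \<Rightarrow> real) \<Rightarrow> bool" where
  "cf_tails a X \<longleftrightarrow> (\<forall>k. a k \<ge> 1 \<and> 0 < X k \<and> X k < 1 \<and> X k = 1 / (real (a k) + X (Suc k)))"

lemma cf_tailsD:
  assumes "cf_tails a X"
  shows "a k \<ge> 1" "0 < X k" "X k < 1" "X k * (real (a k) + X (Suc k)) = 1"
proof -
  have X: "a k \<ge> 1" "0 < X k" "X k < 1" "X k = 1 / (real (a k) + X (Suc k))" "0 < X (Suc k)"
    using assms unfolding cf_tails_def by blast+
  then show "a k \<ge> 1" "0 < X k" "X k < 1" by blast+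
  have "real (a k) + X (Suc k) \<noteq> 0" using X(1,5) by linarith
  then show "X k * (real (a k) + X (Suc k)) = 1" using X(4) by (metis nonzero_eq_divide_eq)
qed

lemma cf_tails_gauss_map:
  assumes "x \<in> cf_set A" "0 \<notin> A"
  shows "cf_tails (cf_digit x) (\<lambda>n. (gauss_map ^^ n) x)"
  unfolding cf_tails_def
proof
  fix k
  have "cf_digit x k \<in> A" using assms(1) by (simp add: cf_set_def)
  then have "cf_digit x k \<ge> 1" using assms(2) by (metis less_one not_le)
  then show "1 \<le> cf_digit x k \<and> 0 < (gauss_map ^^ k) x \<and> (gauss_map ^^ k) x < 1 \<and>
      (gauss_map ^^ k) x = 1 / (real (cf_digit x k) + (gauss_map ^^ Suc k) x)"
    using cf_tail[OF assms(1), of k] by (simp only: greaterThanLessThan_iff)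
qed

lemma cf_tails_diff:
  assumes "cf_tails a X" "cf_tails a' Y"
  shows "\<bar>X k - Y k\<bar> = X k * Y k * \<bar>real (a k) - real (a' k) + (X (Suc k) - Y (Suc k))\<bar>"
proof -
  note X = cf_tailsD[OF assms(1), of k] and Y = cf_tailsD[OF assms(2), of k]
  have "X k - Y k = X k * (Y k * (real (a' k) + Y (Suc k))) - Y k * (X k * (real (a k) + X (Suc k)))"
    using X(4) Y(4) by simp
  also have "\<dots> = - (X k * Y k * (real (a k) - real (a' k) + (X (Suc k) - Y (Suc k))))"
    by (simp add: algebra_simps)
  finally show ?thesis using X(2) Y(2) by (simp add: abs_mult)
qed

text \<open>While the digits agree they cancel in \<open>cf_tails_diff\<close>, and each level
  contributes only the factor \<open>X k * Y k\<close>.\<close>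

lemma cf_tails_diff_prod:
  assumes "cf_tails a X" "cf_tails a' Y" "\<And>k. k < n \<Longrightarrow> a k = a' k"
  shows "\<bar>X 0 - Y 0\<bar> = (\<Prod>k<n. X k) * (\<Prod>k<n. Y k) * \<bar>X n - Y n\<bar>"
  using assms(3)
proof (induction n)
  case (Suc n)
  then show ?case using cf_tails_diff[OF assms(1,2), of n] by simp
qed simp

text \<open>The pair of the denominators of the convergents of index \<open>n - 1\<close> and \<open>n\<close>.\<close>

primrec continuant :: "(nat \<Rightarrow> nat) \<Rightarrow> nat \<Rightarrow> nat \<times> nat" where
  "continuant a 0 = (0, 1)"
| "continuant a (Suc n) = (snd (continuant a n), a n * snd (continuant a n) + fst (continuant a n))"

lemma continuant_mono:
  assumes "\<And>k. b k \<le> a k"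
  shows "fst (continuant b n) \<le> fst (continuant a n) \<and> snd (continuant b n) \<le> snd (continuant a n)"
  by (induction n) (auto intro!: add_mono mult_mono assms)

lemma continuant_fst_le_snd:
  assumes "\<And>k. 1 \<le> a k"
  shows "fst (continuant a n) \<le> snd (continuant a n)"
proof (cases n)
  case (Suc m)
  have "1 * snd (continuant a m) \<le> a m * snd (continuant a m)"
    using assms[of m] by (intro mult_right_mono) auto
  then have "snd (continuant a m) \<le> a m * snd (continuant a m) + fst (continuant a m)" by linarith
  then show ?thesis using Suc by (simp only: continuant.simps fst_conv snd_conv)
qed simp

text \<open>Linear growth suffices for uniqueness of expansions. The bound on the first component is
  carried along because it provides the increment of 1 at each step.\<close>

lemma continuant_ge:
  assumes "\<And>k. 1 \<le> a k"
  shows "n \<le> snd (continuant a n) \<and> 1 \<le> snd (continuant a n) \<and> (n \<ge> 1 \<longrightarrow> 1 \<le> fst (continuant a n))"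
proof (induction n)
  case (Suc n)
  have "1 * snd (continuant a n) \<le> a n * snd (continuant a n)"
    using assms[of n] by (intro mult_right_mono) auto
  then have "Suc n \<le> a n * snd (continuant a n) + fst (continuant a n)"
    using Suc by (cases "n = 0") linarith+
  moreover from this have "1 \<le> a n * snd (continuant a n) + fst (continuant a n)" by linarith
  ultimately show ?case using Suc by (simp only: continuant.simps fst_conv snd_conv simp_thms)
qed simp

text \<open>The classical identity that the product of the first n tails is the reciprocal of q_n +
  q_(n-1) * X n.\<close>

lemma cf_tails_prod_continuant:
  assumes "cf_tails a X"
  shows "(\<Prod>k<n. X k) * (real (snd (continuant a n)) + real (fst (continuant a n)) * X n) = 1"
proof (induction n)
  case (Suc n)
  let ?p = "real (fst (continuant a n))" and ?q = "real (snd (continuant a n))"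
  have "X n * (real (a n) * ?q + ?p + ?q * X (Suc n)) = X n * (real (a n) + X (Suc n)) * ?q + ?p * X n"
    by (simp add: algebra_simps)
  also have "\<dots> = ?q + ?p * X n" using cf_tailsD(4)[OF assms, of n] by simp
  finally show ?case using Suc by (simp add: mult.assoc)
qed simp

lemma cf_tails_prod_pos: "cf_tails a X \<Longrightarrow> 0 < (\<Prod>k<n. X k)"
  by (intro prod_pos) (auto dest: cf_tailsD(2))

text \<open>The reciprocal of each product lies between q_n and 2 * q_n, and q_n is monotone in the
  digits; the tails themselves need not be comparable, which costs the factor 2.\<close>

lemma cf_tails_prod_le:
  assumes a: "cf_tails a X" and b: "cf_tails b X'" and le: "\<And>k. b k \<le> a k"
  shows "(\<Prod>k<n. X k) \<le> 2 * (\<Prod>k<n. X' k)"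
proof -
  define P where "P = (\<Prod>k<n. X k)"
  define P' where "P' = (\<Prod>k<n. X' k)"
  define D where "D = real (snd (continuant a n)) + real (fst (continuant a n)) * X n"
  define D' where "D' = real (snd (continuant b n)) + real (fst (continuant b n)) * X' n"
  have "real (fst (continuant b n)) * X' n \<le> real (snd (continuant b n)) * 1"
    using continuant_fst_le_snd[of b n] cf_tailsD[OF b] by (intro mult_mono) (auto simp: less_imp_le)
  then have "D' \<le> 2 * real (snd (continuant b n))" by (simp add: D'_def)
  also have "\<dots> \<le> 2 * real (snd (continuant a n))" using continuant_mono[OF le] by simp
  also have "\<dots> \<le> 2 * D" using cf_tailsD(2)[OF a, of n] by (simp add: D_def)
  finally have D: "D' \<le> 2 * D" .
  have PD: "P * D = 1" "P' * D' = 1" "P > 0" "P' > 0"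
    using cf_tails_prod_continuant a b cf_tails_prod_pos unfolding P_def P'_def D_def D'_def by blast+
  have "P = P * (P' * D')" using PD by simp
  also have "\<dots> \<le> P * (P' * (2 * D))" using D PD by (intro mult_left_mono) auto
  also have "\<dots> = 2 * P' * (P * D)" by (simp add: algebra_simps)
  finally show ?thesis using PD by (simp add: P_def P'_def)
qed

text \<open>By linear growth of the continuants the product of the first \<open>n\<close> tails is
  at most 1/n, and the remaining factors of \<open>cf_tails_diff_prod\<close> are at most 1.\<close>

lemma cf_tails_unique:
  assumes X: "cf_tails a X" and Y: "cf_tails a Y"
  shows "X 0 = Y 0"
proof (rule ccontr)
  assume "X 0 \<noteq> Y 0"
  then obtain n :: nat where n: "n > 0" "1 / real n < \<bar>X 0 - Y 0\<bar>"
    using real_arch_inverse[of "\<bar>X 0 - Y 0\<bar>"] by (auto simp: inverse_eq_divide)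
  have le: "(\<Prod>k<n. X k) \<le> 1 / real n"
  proof -
    have "real n \<le> real (snd (continuant a n)) + real (fst (continuant a n)) * X n"
      using continuant_ge[of a n] cf_tailsD(1,2)[OF X] by (simp add: add_increasing2 less_imp_le)
    then have "(\<Prod>k<n. X k) * real n \<le> 1"
      using cf_tails_prod_continuant[OF X, of n] cf_tails_prod_pos[OF X, of n]
      by (metis less_imp_le mult_left_mono)
    then show ?thesis using n by (simp add: field_simps)
  qed
  have "(\<Prod>k<n. Y k) \<le> 1"
    using cf_tailsD[OF Y] by (intro prod_le_1) (auto simp: less_imp_le)
  moreover have "\<bar>X n - Y n\<bar> \<le> 1" using cf_tailsD(2,3)[OF X, of n] cf_tailsD(2,3)[OF Y, of n] by linarith
  ultimately have "(\<Prod>k<n. X k) * (\<Prod>k<n. Y k) * \<bar>X n - Y n\<bar> \<le> 1 / real n * 1 * 1"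
    using le cf_tails_prod_pos[OF X, of n] cf_tails_prod_pos[OF Y, of n]
    by (intro mult_mono) (auto intro: less_imp_le)
  then show False using n cf_tails_diff_prod[OF X Y, of n] by simp
qed

text \<open>Lowering the digits only decreases the continuants, and since distinct new digits
  are at distance at least 2, numbers separated at stage \<open>n\<close> stay apart by an amount
  comparable to the length of their common cylinder.\<close>

lemma delta_le_dominated:
  assumes fin: "finite A" and \<phi>: "\<And>a. a \<in> A \<Longrightarrow> \<phi> a \<in> B \<and> 1 \<le> \<phi> a \<and> \<phi> a \<le> a"
    and sep: "\<And>a a'. a \<in> A \<Longrightarrow> a' \<in> A \<Longrightarrow> a \<noteq> a' \<Longrightarrow> \<bar>real (\<phi> a) - real (\<phi> a')\<bar> \<ge> 2"
    and B: "0 \<notin> B"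
  shows "delta A \<le> delta B"
proof -
  have A: "0 \<notin> A" using \<phi>[of 0] by auto
  have dig: "cf_digit x n \<in> A" if "x \<in> cf_set A" for x n using that by (simp add: cf_set_def)
  have "\<exists>y\<in>cf_set B. \<forall>n. cf_digit y n = \<phi> (cf_digit x n)" if "x \<in> cf_set A" for x
    using \<phi> dig[OF that] by (intro cf_digits_realizable) auto
  then obtain g where g: "\<And>x. x \<in> cf_set A \<Longrightarrow> g x \<in> cf_set B"
    "\<And>x n. x \<in> cf_set A \<Longrightarrow> cf_digit (g x) n = \<phi> (cf_digit x n)" by metis
  obtain M where M: "\<And>a. a \<in> A \<Longrightarrow> a \<le> M" using fin by (metis finite_nat_set_iff_bounded_le)
  \<comment> \<open>The 4 is a factor 2 from \<open>cf_tails_prod_le\<close> for each of the two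
    points; \<open>M + 1\<close> bounds the difference of two digits plus that of two tails.\<close>
  define L where "L = 4 * (real M + 1)"
  show ?thesis unfolding delta_def
  proof (rule hausdorff_dim_le_expanding[where L = L and g = g])
    show "L > 0" by (simp add: L_def)
    show "g ` cf_set A \<subseteq> cf_set B" using g by blast
    show "cf_set B \<subseteq> {0<..<1}" by (auto simp: cf_set_def)
    fix x y assume x: "x \<in> cf_set A" and y: "y \<in> cf_set A"
    define X where "X n = (gauss_map ^^ n) x" for n
    define Y where "Y n = (gauss_map ^^ n) y" for n
    define X' where "X' n = (gauss_map ^^ n) (g x)" for n
    define Y' where "Y' n = (gauss_map ^^ n) (g y)" for n
    have T: "cf_tails (cf_digit x) X" "cf_tails (cf_digit y) Y"
        "cf_tails (cf_digit (g x)) X'" "cf_tails (cf_digit (g y)) Y'"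
      unfolding X_def Y_def X'_def Y'_def
      using cf_tails_gauss_map[OF _ A] cf_tails_gauss_map[OF _ B] x y g(1) by blast+
    have zero: "X 0 = x" "Y 0 = y" "X' 0 = g x" "Y' 0 = g y"
      by (simp_all add: X_def Y_def X'_def Y'_def)
    show "\<bar>x - y\<bar> \<le> L * \<bar>g x - g y\<bar>"
    proof (cases "\<exists>n. cf_digit x n \<noteq> cf_digit y n")
      case False
      then have "cf_digit x = cf_digit y" by auto
      then have "x = y" using cf_tails_unique[OF T(1), of Y] T(2) zero by simp
      then show ?thesis by simp
    next
      case True
      define n where "n = (LEAST n. cf_digit x n \<noteq> cf_digit y n)"
      have n: "cf_digit x n \<noteq> cf_digit y n" "\<And>k. k < n \<Longrightarrow> cf_digit x k = cf_digit y k"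
        using LeastI_ex[OF True] not_less_Least unfolding n_def by blast+
      have expand: "\<bar>u - v\<bar> = (\<Prod>k<Suc n. U k) * (\<Prod>k<Suc n. V k) *
          \<bar>real (a n) - real (a' n) + (U (Suc n) - V (Suc n))\<bar>"
        if "cf_tails a U" "cf_tails a' V" "\<And>k. k < n \<Longrightarrow> a k = a' k" "U 0 = u" "V 0 = v"
        for a a' U V u v
        using cf_tails_diff_prod[OF that(1-3)] cf_tails_diff[OF that(1,2), of n] that(4,5) by simp
      define P where "P = (\<Prod>k<Suc n. X k) * (\<Prod>k<Suc n. Y k)"
      define P' where "P' = (\<Prod>k<Suc n. X' k) * (\<Prod>k<Suc n. Y' k)"
      define s where "s = \<bar>real (cf_digit x n) - real (cf_digit y n) + (X (Suc n) - Y (Suc n))\<bar>"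
      define s' where "s' = \<bar>real (cf_digit (g x) n) - real (cf_digit (g y) n) + (X' (Suc n) - Y' (Suc n))\<bar>"
      have xy: "\<bar>x - y\<bar> = P * s" and gxy: "\<bar>g x - g y\<bar> = P' * s'"
        using expand[OF T(1,2) n(2) zero(1,2)] expand[OF T(3,4) _ zero(3,4)] n(2) x y g(2)
        unfolding P_def P'_def s_def s'_def by simp_all
      have le: "cf_digit (g u) k \<le> cf_digit u k" if "u \<in> cf_set A" for u k
        using g(2)[OF that] \<phi>[OF dig[OF that]] by simp
      have "P \<le> (2 * (\<Prod>k<Suc n. X' k)) * (2 * (\<Prod>k<Suc n. Y' k))"
        unfolding P_def
        using cf_tails_prod_le[OF T(1,3) le[OF x]] cf_tails_prod_le[OF T(2,4) le[OF y]]
          cf_tails_prod_pos[OF T(2)] cf_tails_prod_pos[OF T(3)]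
        by (intro mult_mono) (auto simp del: prod.lessThan_Suc intro: less_imp_le)
      then have P: "P \<le> 4 * P'" by (simp add: P'_def)
      have P'0: "P' > 0" unfolding P'_def by (intro mult_pos_pos cf_tails_prod_pos[OF T(3)] cf_tails_prod_pos[OF T(4)])
      have "s \<le> real M + 1"
        using M[OF dig[OF x], of n] M[OF dig[OF y], of n]
          cf_tailsD(2,3)[OF T(1), of "Suc n"] cf_tailsD(2,3)[OF T(2), of "Suc n"]
        unfolding s_def by linarith
      \<comment> \<open>Here the separation by 2 is used: the tails differ by less than 1, so they
        cannot cancel the difference of the new digits.\<close>
      moreover have "s' \<ge> 1"
        using sep[OF dig[OF x] dig[OF y] n(1)] g(2)[OF x, of n] g(2)[OF y, of n]
          cf_tailsD(2,3)[OF T(3), of "Suc n"] cf_tailsD(2,3)[OF T(4), of "Suc n"]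
        unfolding s'_def by linarith
      moreover from this have "(real M + 1) * 1 \<le> (real M + 1) * s'" by (intro mult_left_mono) auto
      ultimately have "s \<le> (real M + 1) * s'" by (metis mult.right_neutral order_trans)
      then have "P * s \<le> (4 * P') * ((real M + 1) * s')"
        using P P'0 by (intro mult_mono) (auto simp: s_def)
      then show ?thesis unfolding xy gxy L_def by (simp add: mult_ac)
    qed
  qed
qed

lemma delta_le_progression:
  assumes fin: "finite A" and A: "\<And>a. a \<in> A \<Longrightarrow> \<exists>k. a = a\<^sub>0 + d * k"
    and "1 \<le> c" "c \<le> a\<^sub>0" "2 \<le> e" "e \<le> d \<or> A \<subseteq> {a\<^sub>0}"
    and B: "0 \<notin> B" "\<And>k. c + e * k \<in> B"
  shows "delta A \<le> delta B"
proof -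
  \<comment> \<open>In the degenerate cases \<open>k\<close> is fixed as 0, since otherwise an
    arbitrary \<open>k\<close> could make the new digit exceed \<open>a\<close>.\<close>
  have "\<exists>k. a = a\<^sub>0 + d * k \<and> (d = 0 \<or> A \<subseteq> {a\<^sub>0} \<longrightarrow> k = 0)" if "a \<in> A" for a
    using A[OF that] that by (cases "d = 0 \<or> A \<subseteq> {a\<^sub>0}") auto
  then obtain k where k: "\<And>a. a \<in> A \<Longrightarrow> a = a\<^sub>0 + d * k a"
    "\<And>a. a \<in> A \<Longrightarrow> d = 0 \<or> A \<subseteq> {a\<^sub>0} \<Longrightarrow> k a = 0" by metis
  show ?thesis
  proof (rule delta_le_dominated[OF fin, where \<phi> = "\<lambda>a. c + e * k a"])
    fix a assume a: "a \<in> A"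
    have "e * k a \<le> d * k a" using assms(6) k(2)[OF a] by (cases "e \<le> d") auto
    then have "c + e * k a \<le> a" using k(1)[OF a] assms(4) by linarith
    then show "c + e * k a \<in> B \<and> 1 \<le> c + e * k a \<and> c + e * k a \<le> a" using B assms(3) by simp
  next
    fix a a' assume a: "a \<in> A" "a' \<in> A" "a \<noteq> a'"
    then have "k a \<noteq> k a'" using k(1) by metis
    then have "1 \<le> \<bar>real (k a) - real (k a')\<bar>" by linarith
    then have "2 * 1 \<le> real e * \<bar>real (k a) - real (k a')\<bar>" using assms(5) by (intro mult_mono) auto
    also have "\<dots> = \<bar>real (c + e * k a) - real (c + e * k a')\<bar>"
      by (simp add: right_diff_distrib[symmetric] abs_mult)
    finally show "2 \<le> \<bar>real (c + e * k a) - real (c + e * k a')\<bar>" by simp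
  qed (rule B)
qed

section \<open>Denominators modulo q\<close>

text \<open>Right multiplication of the row (w, z) by the matrix \<open>gamma a\<close>, with an
  integer parameter so that residues may be substituted.\<close>

fun row_step :: "int \<Rightarrow> int \<times> int \<Rightarrow> int \<times> int" where
  "row_step a (w, z) = (z, w + a * z)"

lemma bottom_row_foldr_gamma:
  fixes as :: "nat list"
  defines "M \<equiv> foldr (**) (map gamma as) (mat 1)"
  shows "(M $ 2 $ 1, M $ 2 $ 2) = foldl (\<lambda>r a. row_step (int a) r) (0, 1) as"
  unfolding M_def
proof (induction as rule: rev_induct)
  case Nil
  then show ?case by (simp add: mat_def)
next
  case (snoc a as)
  have app: "foldr (**) Ms X = foldr (**) Ms (mat 1) ** X" for Ms :: "(int^2^2) list" and X
    by (induction Ms) (simp_all add: matrix_mul_assoc)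
  show ?case
    unfolding foldl_append snoc.IH[symmetric]
    by (simp add: app[of _ "gamma a"] matrix_mul_rid)
       (simp add: matrix_matrix_mult_def gamma_def sum_2 mult.commute)
qed

definition residue_rows :: "nat set \<Rightarrow> int \<Rightarrow> (int \<times> int) set" where
  "residue_rows A q = {(w, z). \<exists>as w' z'. as \<noteq> [] \<and> set as \<subseteq> A \<and>
     foldl (\<lambda>r a. row_step (int a) r) (0, 1) as = (w', z') \<and> [w = w'] (mod q) \<and> [z = z'] (mod q)}"

lemma residue_rows_denominator:
  assumes "(w, z) \<in> residue_rows A q"
  shows "\<exists>m\<in>denominators A. z mod q = m mod q"
proof -
  obtain as w' z' where as: "as \<noteq> []" "set as \<subseteq> A" and
    eq: "foldl (\<lambda>r a. row_step (int a) r) (0, 1) as = (w', z')" and "[z = z'] (mod q)"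
    using assms unfolding residue_rows_def by auto
  moreover have "z' \<in> denominators A"
    unfolding denominators_def semigroup_G_def
    using bottom_row_foldr_gamma[of as] as eq by (auto intro!: exI[of _ as])
  ultimately show ?thesis by (auto simp: cong_def)
qed

lemma residue_rows_cong:
  assumes "(w, z) \<in> residue_rows A q" "[w' = w] (mod q)" "[z' = z] (mod q)"
  shows "(w', z') \<in> residue_rows A q"
  using assms unfolding residue_rows_def by (auto intro: cong_trans)

lemma residue_rows_step:
  assumes "(w, z) \<in> residue_rows A q" "a \<in> A"
  shows "(z, w + int a * z) \<in> residue_rows A q"
proof -
  obtain as w' z' where as: "as \<noteq> []" "set as \<subseteq> A" and
    eq: "foldl (\<lambda>r a. row_step (int a) r) (0, 1) as = (w', z')" and
    c: "[w = w'] (mod q)" "[z = z'] (mod q)"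
    using assms unfolding residue_rows_def by auto
  have "foldl (\<lambda>r a. row_step (int a) r) (0, 1) (as @ [a]) = (z', w' + int a * z')"
    using eq by simp
  moreover have "[w + int a * z = w' + int a * z'] (mod q)"
    using c by (intro cong_add cong_mult) auto
  ultimately show ?thesis using c as assms(2) unfolding residue_rows_def
    by (intro CollectI case_prodI exI[of _ "as @ [a]"]) auto
qed

text \<open>On the finite set of reduced rows each generator acts injectively, hence surjectively:
  modulo \<open>q\<close> the semigroup is a group.\<close>

lemma residue_rows_step_back:
  assumes r: "(w, z) \<in> residue_rows A q" and a: "a \<in> A" and q: "q \<ge> 1"
  shows "(z - int a * w, w) \<in> residue_rows A q"
proof -
  define S where "S = residue_rows A q \<inter> {0..<q} \<times> {0..<q}"
  define f where "f = (\<lambda>(w, z). (z mod q, (w + int a * z) mod q))"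
  have red: "(u mod q, v mod q) \<in> S" if "(u, v) \<in> residue_rows A q" for u v
    using residue_rows_cong[OF that, of "u mod q" "v mod q"] q by (auto simp: S_def)
  have "f ` S \<subseteq> S"
  proof
    fix y assume "y \<in> f ` S"
    then obtain u v where "(u, v) \<in> residue_rows A q" "y = f (u, v)" by (auto simp: S_def)
    then show "y \<in> S" using red[OF residue_rows_step[OF _ a]] by (simp add: f_def)
  qed
  moreover have "inj_on f S"
  proof (rule inj_onI, clarify)
    fix u v u' v' assume S: "(u, v) \<in> S" "(u', v') \<in> S" and eq: "f (u, v) = f (u', v')"
    then have v: "v = v'" by (auto simp: f_def S_def)
    then have "[u + int a * v = u' + int a * v] (mod q)" using eq by (simp add: f_def cong_def)
    then have "[u = u'] (mod q)" by (simp add: cong_add_rcancel)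
    then show "u = u' \<and> v = v'" using S v by (auto simp: S_def cong_def)
  qed
  moreover have "finite S" unfolding S_def by auto
  ultimately have "f ` S = S" by (intro endo_inj_surj)
  then obtain u v where uv: "(u, v) \<in> S" "f (u, v) = (w mod q, z mod q)"
    using red[OF r] by (metis imageE surj_pair)
  have c: "[v = w] (mod q)" "[u + int a * v = z] (mod q)" using uv(2) by (auto simp: f_def cong_def)
  have "[u + int a * v - int a * v = z - int a * w] (mod q)"
    using c by (intro cong_diff cong_mult) auto
  then have "[u = z - int a * w] (mod q)" by simp
  then show ?thesis
    using residue_rows_cong[OF _ cong_sym[of u] cong_sym[OF c(1)]] uv(1) by (simp add: S_def)
qed

text \<open>The bottom row of the identity is present although the empty word is excluded: it is one
  step back from the row of a single generator.\<close>

lemma residue_rows_unit: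
  assumes "a \<in> A" "q \<ge> 1"
  shows "(0, 1) \<in> residue_rows A q"
proof -
  have "(1, int a) \<in> residue_rows A q"
    unfolding residue_rows_def using assms by (auto intro!: exI[of _ "[a]"])
  then show ?thesis using residue_rows_step_back[of 1 "int a" A q a] assms by simp
qed

section \<open>Elementary matrices modulo q and the denominators they reach\<close>

lemma Gcd_mem_additive:
  fixes C :: "int set"
  assumes "finite S" "S \<subseteq> C" "0 \<in> C"
    and add: "\<And>x y. x \<in> C \<Longrightarrow> y \<in> C \<Longrightarrow> x + y \<in> C"
    and mult: "\<And>k x. x \<in> C \<Longrightarrow> k * x \<in> C"
  shows "Gcd S \<in> C"
  using assms(1,2)
proof (induction S rule: finite_induct)
  case (insert x S)
  obtain u v where "u * x + v * Gcd S = gcd x (Gcd S)" using bezout_int by blast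
  then show ?case using insert add[OF mult mult] by (metis Gcd_insert insert_subset)
qed (use assms in simp)

text \<open>These are the \<open>c\<close> for which right multiplication by both elementary
  matrices with off-diagonal entry \<open>c\<close> preserves the rows; they turn out to form an
  ideal.\<close>

definition row_shears :: "nat set \<Rightarrow> int \<Rightarrow> int set" where
  "row_shears A q = {c. \<forall>w z. (w, z) \<in> residue_rows A q \<longrightarrow>
     (w, z + c * w) \<in> residue_rows A q \<and> (w + c * z, z) \<in> residue_rows A q}"

lemma row_shears_add:
  assumes "x \<in> row_shears A q" "y \<in> row_shears A q"
  shows "x + y \<in> row_shears A q"
proof -
  have "(w, z + (x + y) * w) \<in> residue_rows A q \<and> (w + (x + y) * z, z) \<in> residue_rows A q"
    if r: "(w, z) \<in> residue_rows A q" for w z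
  proof -
    have "(w, (z + x * w) + y * w) \<in> residue_rows A q" "((w + x * z) + y * z, z) \<in> residue_rows A q"
      using assms r unfolding row_shears_def by blast+
    then show ?thesis by (simp add: algebra_simps)
  qed
  then show ?thesis by (simp add: row_shears_def)
qed

text \<open>Repeated addition gives the nonnegative multiples, and \<open>k\<close> may be replaced
  by \<open>k mod q\<close> because rows matter only modulo \<open>q\<close>.\<close>

lemma row_shears_mult:
  assumes x: "x \<in> row_shears A q" and q: "q \<ge> 1"
  shows "k * x \<in> row_shears A q"
proof -
  have nat: "int n * x \<in> row_shears A q" for n
  proof (induction n)
    case 0
    show ?case by (simp add: row_shears_def)
  next
    case (Suc n)
    then show ?case using row_shears_add[OF x Suc] by (simp add: algebra_simps)
  qed
  have k: "k mod q * x \<in> row_shears A q" using nat[of "nat (k mod q)"] q by simp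
  have "(w, z + k * x * w) \<in> residue_rows A q \<and> (w + k * x * z, z) \<in> residue_rows A q"
    if r: "(w, z) \<in> residue_rows A q" for w z
  proof -
    have "(w, z + k mod q * x * w) \<in> residue_rows A q" "(w + k mod q * x * z, z) \<in> residue_rows A q"
      using k r unfolding row_shears_def by blast+
    moreover have "[k * x * u = k mod q * x * u] (mod q)" for u
      by (intro cong_mult) (auto simp: cong_def)
    ultimately show ?thesis
      by (meson residue_rows_cong cong_add cong_refl)
  qed
  then show ?thesis by (simp add: row_shears_def)
qed

text \<open>The products gamma_a^(-1) gamma_b and gamma_b gamma_a^(-1) are the upper and lower
  elementary matrices with entry b - a.\<close>

lemma row_shears_diff:
  assumes "a \<in> A" "b \<in> A" "q \<ge> 1"
  shows "int b - int a \<in> row_shears A q"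
proof -
  have "(w, z + (int b - int a) * w) \<in> residue_rows A q"
    "(w + (int b - int a) * z, z) \<in> residue_rows A q" if r: "(w, z) \<in> residue_rows A q" for w z
    using residue_rows_step[OF residue_rows_step_back[OF r assms(1,3)] assms(2)]
      residue_rows_step_back[OF residue_rows_step[OF r assms(2)] assms(1,3)]
    by (simp_all add: algebra_simps)
  then show ?thesis by (simp add: row_shears_def)
qed

text \<open>Take for \<open>y\<close> the product of the primes of \<open>q\<close> not dividing
  \<open>u\<close>: each prime of \<open>q\<close> then divides exactly one of \<open>u\<close> and
  \<open>v * y\<close>.\<close>

lemma coprime_shift_exists:
  fixes u v q :: int
  assumes "coprime u v" "q \<noteq> 0"
  shows "\<exists>y. coprime (u + v * y) q"
proof -
  define P where "P = {p \<in> prime_factors q. \<not> p dvd u}"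
  have fin: "finite P" by (simp add: P_def)
  have "coprime (u + v * \<Prod>P) q"
  proof (rule ccontr)
    assume "\<not> coprime (u + v * \<Prod>P) q"
    then obtain p where p: "prime p" "p dvd u + v * \<Prod>P" "p dvd q"
      using assms(2) prime_divisor_exists[of "gcd (u + v * \<Prod>P) q"] by auto
    show False
    proof (cases "p dvd u")
      case True
      then have "p dvd v * \<Prod>P" using p(2) by (simp add: dvd_add_right_iff)
      then consider "p dvd v" | "p dvd \<Prod>P" using p(1) prime_dvd_mult_iff by blast
      then show False
      proof cases
        case 1
        then show False using True assms(1) p(1) by (meson coprime_common_divisor not_prime_unit)
      next
        case 2
        then obtain r where "r \<in> P" "p dvd r" using p(1) fin by (auto simp: prime_dvd_prod_iff)
        then have "p = r" using p(1) primes_dvd_imp_eq by (auto simp: P_def)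
        then show False using \<open>r \<in> P\<close> True by (auto simp: P_def)
      qed
    next
      case False
      then have "p \<in> P" using p assms(2) by (auto simp: P_def prime_factors_dvd)
      then have "p dvd v * \<Prod>P" using dvd_prodI[OF fin, of p "\<lambda>x. x"] by simp
      then show False using False p(2) by (simp add: dvd_add_left_iff)
    qed
  qed
  then show ?thesis by blast
qed

text \<open>A first shear changes \<open>w\<close> into gcd w d times a unit modulo
  \<open>q\<close>. Shearing \<open>z\<close> by multiples of \<open>d\<close> times this entry then
  reaches every \<open>t\<close> congruent to \<open>z\<close> modulo
  \<open>d * gcd w d\<close>.\<close>

lemma residue_rows_reach:
  assumes r: "(w, z) \<in> residue_rows A q" and cop: "coprime w z" and q: "q \<ge> 1"
    and d: "d \<in> row_shears A q" "d > 0" and t: "d * gcd w d dvd t - z"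
  shows "\<exists>w'. (w', t) \<in> residue_rows A q"
proof -
  define g where "g = gcd w d"
  have g: "g > 0" using d(2) by (simp add: g_def)
  \<comment> \<open>After division by \<open>g\<close>, \<open>w0\<close> is coprime to
    \<open>d0 * z\<close>, as required for shifting it to a unit modulo \<open>q\<close>.\<close>
  obtain w0 d0 where w0: "w = g * w0" and d0: "d = g * d0" and "coprime w0 d0"
    using gcd_coprime_exists[of w d] g unfolding g_def by (metis less_irrefl mult.commute)
  moreover have "coprime w0 z" using cop unfolding w0 by simp
  ultimately obtain y where y: "coprime (w0 + d0 * z * y) q"
    using coprime_shift_exists[of w0 "d0 * z" q] q by auto
  define w1 where "w1 = w0 + d0 * z * y"
  obtain s where s: "t = z + d * g * s" using t unfolding g_def[symmetric] by (auto simp: dvd_def algebra_simps)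
  obtain x where x: "[w1 * x = s] (mod q)"
    using y cong_solve_coprime_int[of w1 q] unfolding w1_def[symmetric]
    by (metis cong_scalar_right mult.assoc mult_1)
  have "(w + y * d * z, z) \<in> residue_rows A q"
    using row_shears_mult[OF d(1) q, of y] r by (simp add: row_shears_def)
  moreover have "w + y * d * z = g * w1" unfolding w1_def by (simp add: w0 d0 algebra_simps)
  ultimately have "(g * w1, z + x * d * (g * w1)) \<in> residue_rows A q"
    using row_shears_mult[OF d(1) q, of x] by (simp add: row_shears_def)
  moreover have "[t = z + x * d * (g * w1)] (mod q)"
  proof -
    have "[z + d * g * s = z + d * g * (w1 * x)] (mod q)"
      using cong_sym[OF x] by (intro cong_add cong_mult) auto
    then show ?thesis unfolding s by (simp add: algebra_simps)
  qed
  ultimately show ?thesis using residue_rows_cong[OF _ cong_refl] by blast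
qed

section \<open>Powers of a single generator and the finite check\<close>

lemma row_step_iterate_cong:
  assumes "[a = b] (mod m)"
  shows "[fst ((row_step a ^^ n) (0, 1)) = fst ((row_step b ^^ n) (0, 1))] (mod m) \<and>
         [snd ((row_step a ^^ n) (0, 1)) = snd ((row_step b ^^ n) (0, 1))] (mod m)"
proof (induction n)
  case (Suc n)
  then show ?case using assms
    by (cases "(row_step a ^^ n) (0, 1)"; cases "(row_step b ^^ n) (0, 1)")
       (auto intro!: cong_add cong_mult)
qed simp

lemma row_step_iterate_coprime:
  "coprime (fst ((row_step a ^^ n) (0, 1))) (snd ((row_step a ^^ n) (0, 1)))"
proof (induction n)
  case (Suc n)
  obtain w z where wz: "(row_step a ^^ n) (0, 1) = (w, z)" by fastforce
  then have "coprime z (w + a * z)" using Suc gcd_add_mult[of z a w] by (simp add: coprime_iff_gcd_eq_1 gcd.commute add.commute)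
  then show ?case by (simp add: wz)
qed simp

lemma residue_rows_iterate:
  assumes "a \<in> A" "q \<ge> 1"
  shows "(row_step (int a) ^^ n) (0, 1) \<in> residue_rows A q"
proof (induction n)
  case (Suc n)
  then show ?case using residue_rows_step[OF _ assms(1)]
    by (cases "(row_step (int a) ^^ n) (0, 1)") auto
qed (use residue_rows_unit[OF assms] in simp)

text \<open>The rows come from powers of one generator; for \<open>b = 1\<close> they are
  consecutive Fibonacci numbers. Requiring \<open>d * gcd w d\<close> to divide \<open>m\<close>
  makes the test depend only on \<open>t\<close> modulo \<open>m\<close>. The bound 24 is the
  Fibonacci period modulo 6, the longest period among the cases checked.\<close>

definition fib_covers :: "int \<Rightarrow> int \<Rightarrow> int \<Rightarrow> bool" where
  "fib_covers d m b \<longleftrightarrow> (\<forall>t\<in>set [0..m - 1]. \<exists>n\<in>set [0..<24].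
     case (row_step b ^^ n) (0, 1) of (w, z) \<Rightarrow>
       d * gcd w d dvd m \<and> d * gcd w d dvd t - z)"

text \<open>For d = 4 the residue 3 modulo 4 occurs only beside an entry w congruent to 2, so a row
  reaches just a class modulo 8; both 3 and 7 modulo 8 do occur, for either lift 1 or 5 of the
  digit.\<close>

lemma fib_covers_small:
  "fib_covers 1 1 1" "fib_covers 2 2 1" "fib_covers 3 3 1" "fib_covers 4 8 1" "fib_covers 4 8 5"
  "fib_covers 5 5 1" "fib_covers 6 6 1" "fib_covers 7 7 1"
  by code_simp+

lemma fib_covers_reach:
  assumes c: "fib_covers d m b" and m: "m > 0" "d dvd m" and ab: "[int a = b] (mod m)"
    and a: "a \<in> A" and q: "q \<ge> 1" and d: "d \<in> row_shears A q" "d > 0"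
  shows "\<exists>w. (w, t) \<in> residue_rows A q"
proof -
  have tm: "t mod m \<in> set [0..m - 1]" using m by simp
  obtain n where n: "case (row_step b ^^ n) (0, 1) of (w, z) \<Rightarrow>
       d * gcd w d dvd m \<and> d * gcd w d dvd t mod m - z"
    using bspec[OF c[unfolded fib_covers_def] tm] by (elim bexE)
  obtain w z where wz: "(row_step b ^^ n) (0, 1) = (w, z)" by fastforce
  obtain w' z' where wz': "(row_step (int a) ^^ n) (0, 1) = (w', z')" by fastforce
  have cw: "[w' = w] (mod m)" and cz: "[z' = z] (mod m)"
    using row_step_iterate_cong[OF ab, of n] wz wz' by auto
  \<comment> \<open>As \<open>d\<close> divides \<open>m\<close>, replacing the digit by its residue
    \<open>b\<close> does not change this gcd.\<close>
  have g: "gcd w' d = gcd w d"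
    using cong_gcd_eq[OF cong_dvd_modulus[OF cw m(2)]] .
  have "[t mod m - z = t - z'] (mod m)" using cong_sym[OF cz] by (intro cong_diff) (auto simp: cong_def)
  moreover have dm: "d * gcd w d dvd m" and tz: "d * gcd w d dvd t mod m - z" using n wz by simp_all
  ultimately have "d * gcd w d dvd t - z'"
    using cong_dvd_iff[OF cong_dvd_modulus[OF _ dm]] tz by blast
  then show ?thesis
    using residue_rows_reach[of w' z' A q d t] residue_rows_iterate[OF a q, of n]
      row_step_iterate_coprime[of n "int a"] q d by (simp add: wz' g)
qed

lemma no_local_obstructions_if_Gcd_small:
  assumes "finite A" "a\<^sub>0 \<in> A" and d: "d = Gcd ((\<lambda>a. int a - int a\<^sub>0) ` A)"
    and d17: "1 \<le> d" "d \<le> 7" and "[int a\<^sub>0 = 1] (mod d)"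
  shows "no_local_obstructions A"
  unfolding no_local_obstructions_def admissible_def
proof (intro allI impI)
  fix t q :: int assume q: "q \<ge> 1"
  have "0 \<in> row_shears A q" using row_shears_diff[OF assms(2) assms(2) q] by simp
  \<comment> \<open>By Bezout the gcd is an integer combination of the differences of digits, each
    of which is a shear.\<close>
  then have dS: "d \<in> row_shears A q" unfolding d
    using assms(1,2) q by (intro Gcd_mem_additive row_shears_add row_shears_mult)
      (auto intro: row_shears_diff)
  note reach = fib_covers_reach[OF _ _ _ _ assms(2) q dS]
  have "d = 1 \<or> d = 2 \<or> d = 3 \<or> d = 4 \<or> d = 5 \<or> d = 6 \<or> d = 7" using d17 by presburger
  moreover have "[int a\<^sub>0 = 1] (mod 8) \<or> [int a\<^sub>0 = 5] (mod 8)" if "d = 4"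
  proof -
    have "int a\<^sub>0 mod 4 = 1" using assms(6) that by (simp add: cong_def)
    then have "int a\<^sub>0 mod 8 = 1 \<or> int a\<^sub>0 mod 8 = 5" by presburger
    then show ?thesis by (simp add: cong_def)
  qed
  ultimately have "\<exists>m b. fib_covers d m b \<and> m > 0 \<and> d dvd m \<and> [int a\<^sub>0 = b] (mod m)"
  proof (elim disjE)
    assume d4: "d = 4" and "d = 4 \<Longrightarrow> [int a\<^sub>0 = 1] (mod 8) \<or> [int a\<^sub>0 = 5] (mod 8)"
    then consider "[int a\<^sub>0 = 1] (mod 8)" | "[int a\<^sub>0 = 5] (mod 8)" by blast
    then show ?thesis
    proof cases
      case 1
      then show ?thesis using fib_covers_small(4) d4 by (intro exI[of _ 8] exI[of _ 1]) simp
    next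
      case 2
      then show ?thesis using fib_covers_small(5) d4 by (intro exI[of _ 8] exI[of _ 5]) simp
    qed
  qed (use assms(6) fib_covers_small in \<open>intro exI[of _ d] exI[of _ 1]; simp\<close>)+
  then obtain m b where "fib_covers d m b" "m > 0" "d dvd m" "[int a\<^sub>0 = b] (mod m)" by blast
  then have "\<exists>w. (w, t) \<in> residue_rows A q" using reach d17(1) by simp
  then show "\<exists>m\<in>denominators A. t mod q = m mod q" using residue_rows_denominator by blast
qed

section \<open>Restrictions imposed on the progression by the dimension hypothesis\<close>

theorem theoremB11:
  fixes A :: "nat set"
  assumes "finite A" and "0 \<notin> A"
    and "delta A > max (delta A_oct) (delta A_even)"
  shows "no_local_obstructions A"
proof -
  have oct: "0 \<notin> A_oct" "\<And>k. 1 + 8 * k \<in> A_oct" and even: "0 \<notin> A_even" "\<And>k. 2 + 2 * k \<in> A_even"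
    by (auto simp: A_oct_def A_even_def)
  have "A \<noteq> {}"
  proof
    assume "A = {}"
    then have "delta A \<le> delta A_oct" using oct by (intro delta_le_dominated[of A id]) auto
    then show False using assms(3) by simp
  qed
  define a\<^sub>0 where "a\<^sub>0 = Min A"
  define d where "d = Gcd ((\<lambda>a. int a - int a\<^sub>0) ` A)"
  have a0: "a\<^sub>0 \<in> A" "\<And>a. a \<in> A \<Longrightarrow> a\<^sub>0 \<le> a"
    using \<open>A \<noteq> {}\<close> assms(1) by (auto simp: a\<^sub>0_def)
  then have "a\<^sub>0 \<ge> 1" using assms(2) by (metis less_one not_le)
  have "d \<ge> 0" by (simp add: d_def)
  have prog: "\<exists>k. a = a\<^sub>0 + nat d * k" if "a \<in> A" for a
  proof -
    have "d dvd int a - int a\<^sub>0" using that by (auto simp: d_def)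
    then have "nat d dvd a - a\<^sub>0" using a0(2)[OF that] \<open>d \<ge> 0\<close>
      by (metis nat_0_le int_dvd_int_iff of_nat_diff)
    then show ?thesis using a0(2)[OF that] by (metis dvdE le_add_diff_inverse)
  qed
  \<comment> \<open>Otherwise the k-th term of the progression could be lowered to 1 + 8*k, or
    \<open>A\<close> is a single letter and is lowered to 1.\<close>
  have "\<not> (d = 0 \<or> d \<ge> 8)"
  proof
    assume "d = 0 \<or> d \<ge> 8"
    then have "8 \<le> nat d \<or> A \<subseteq> {a\<^sub>0}" using prog by fastforce
    then have "delta A \<le> delta A_oct"
      using delta_le_progression[OF assms(1) prog, of 1 8 A_oct] \<open>a\<^sub>0 \<ge> 1\<close> oct by simp
    then show False using assms(3) by simp
  qed
  then have d17: "1 \<le> d" "d \<le> 7" using \<open>d \<ge> 0\<close> by linarith+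
  \<comment> \<open>Otherwise step and least element are both at least 2, and the k-th term could be
    lowered to 2 + 2*k.\<close>
  have "d = 1 \<or> a\<^sub>0 = 1"
  proof (rule ccontr)
    assume "\<not> (d = 1 \<or> a\<^sub>0 = 1)"
    then have "2 \<le> nat d" "2 \<le> a\<^sub>0" using d17 \<open>a\<^sub>0 \<ge> 1\<close> by linarith+
    then have "delta A \<le> delta A_even"
      using delta_le_progression[OF assms(1) prog, of 2 2 A_even] even by simp
    then show False using assms(3) by simp
  qed
  then have "[int a\<^sub>0 = 1] (mod d)" by (auto simp: cong_def)
  then show ?thesis using no_local_obstructions_if_Gcd_small[OF assms(1) a0(1) d_def d17] by simp
qed

end
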